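(* Consider the constrained multiobjective problem $\min_{x\in\Omega} f(x)=(f_1(x),\dots,f_m(x))^\top$ with $\Omega=\{x\in\mathcal X: c_j(x)\le 0,\ j\in\mathcal J\}\subset\mathbb R^n$ and constraint violation function $h$, and let DMulti-MADS (either the variant DMulti-MADS-TEB or the variant DMulti-MADS-PB described in the context) be run from the initial set $V^0$. Assume that (i) there is some $x^0\in V^0$ with $x^0\in\mathcal X$ and $f(x^0)$, $h(x^0)$ both finite, and (ii) all iterates considered by the algorithm lie in a bounded set. Suppose DMulti-MADS generates a feasible refining subsequence $\{x_F^k\}_{k\in K}$, with $x_F^k\in F^k$, converging to a refining point $\hat x_F\in\Omega$. Assume that $f$ is Lipschitz continuous near $\hat x_F$ and $T^H_\Omega(\hat x_F)\ne\emptyset$. If the set of refining directions for $\hat x_F$ is dense in (the set of unit vectors of) $T^{Cl}_\Omega(\hat x_F)$, then $\hat x_F$ is a Pareto-Clarke critical point of $f$ in $\Omega$, i.e. for every $d\in T^{Cl}_\Omega(\hat x_F)$ there exists $i(d)\in\{1,\dots,m\}$ such that $f^o_{i(d)}(\hat x_F;d)\ge0$.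
   Context: **Problem.** $\mathcal X\subseteq\mathbb R^n$; $f_i:\mathbb R^n\to\mathbb R\cup\{+\infty\}$ ($i=1,\dots,m$) and $c_j:\mathbb R^n\to\mathbb R\cup\{+\infty\}$ ($j\in\mathcal J$, finite) are given functions; $\Omega=\{x\in\mathcal X:c_j(x)\le0,\ j\in\mathcal J\}$. The constraint violation function is $h(x)=\sum_{j\in\mathcal J}(\max\{c_j(x),0\})^2$ if $x\in\mathcal X$ and $h(x)=+\infty$ otherwise; so $x\in\Omega$ iff $h(x)=0$. **Dominance.** For $x^1,x^2\in\Omega$: $x^1\prec_f x^2$ iff $f_i(x^1)\le f_i(x^2)$ for all $i$ with at least one strict inequality. For $x^1,x^2\in\mathcal X\setminus\Omega$: $x^1\prec_h x^2$ iff $f_i(x^1)\le f_i(x^2)$ for all $i$ and $h(x^1)\le h(x^2)$, with at least one strict inequality. Feasible and infeasible points are never compared. **Common structure.** $V^k\subset\mathcal X$ is the finite set of points evaluated by the start of iteration $k$; $V^0\ne\emptyset$ is given; $V^{k+1}$ is $V^k$ together with all points of $\mathcal X$ evaluated during iteration $k$. $F^k$ is the set of points of $V^k\cap\Omega$ not dominated ($\prec_f$) by another point of $V^k\cap\Omega$. $D=GZ\in\mathbb R^{n\times n_D}$ is a fixed matrix whose columns form a positive spanning set of $\mathbb R^n$, $G$ nonsingular, $Z$ an integer matrix. $\tau\in(0,1)\cap\mathbb Q$ and $w^+\in\mathbb N$ are fixed. Incumbents are stored as pairs $(x,\Delta)$ with frame size parameter $\Delta>0$ (initially $\Delta^0$):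 the list $L_F^k$ contains pairs with $x\in F^k$ and (PB only) the list $L_I^k$ contains pairs with $x\in I^k$ (defined below). At iteration $k$ one feasible and/or one infeasible pair is selected as frame center: $(x_F^k,\Delta_F^k)\in L_F^k$ and/or $(x_I^k,\Delta_I^k)\in L_I^k$. Set $\Delta^k=\Delta_F^k$ if $L_F^k\neq\emptyset$, else $\Delta^k=\Delta_I^k$; the mesh size parameter is $\delta^k=\min\{\Delta^k,(\Delta^k)^2\}$, and the mesh is $M^k=\bigcup_{x\in V^k}\{x+\delta^kDz:z\in\mathbb N^{n_D}\}$. The feasible center satisfies $\tau^{w^+}\Delta^k_{\max}\le\Delta_F^k\le\Delta^k_{\max}$, with $\Delta_{\max}^k=\max_{(x,\Delta)\in L_F^k}\Delta$. Each iteration has an optional search (evaluation of finitely many mesh points) and a poll. The poll evaluates points $x+\delta^kd\in M^k$, $d\in\mathbb D^k_\Delta$, around each selected frame center $x$, where $\mathbb D^k_\Delta$ is the finite set of poll directions used around that center (a positive spanning set for the primary center; possibly fewer directions around the secondary center when two centers are used), each direction being a nonnegative integer combination of columns of $D$, and $\delta^k\|d\|\le b\,\Delta^k$ for a constant $b$ independent of $k$. Points outside $\mathcal X$ are rejected. The iteration may stop early only once a success criterion (dominating or improving, below) is met; in an unsuccessful iteration all poll points lying in $\mathcal X$ are evaluated. **DMulti-MADS-PB.** $U^k$ is the set of $x\in V^k\setminus\Omega$ for which no $y\in V^k\setminus\Omega$ satisfies $y\prec_hx$. With a nonnegative threshold $h_{\max}^k$, $I^k$ is the set of points of $\{x\in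 U^k:0<h(x)\le h^k_{\max}\}$ whose vector $f(x)$ is Pareto-nondominated among the points of that set. If $L_F^k=\emptyset$, the infeasible center satisfies $\Delta_I^k\ge\Delta^k_{h_{\min}}$, where $(x^k_{h_{\min}},\Delta^k_{h_{\min}})\in\arg\min_{(x,\Delta)\in L_I^k}h(x)$. If both lists are nonempty, $x_I^k$ maximizes $\psi(x)$ over $L_I^k$, where $\psi(x)=\min_{(x^F,\Delta)\in L_F^k}\sum_i[f_i(x^F)-\min\{f_i(x),f_i(x^F)\}]$ if no $(x^F,\Delta)\in L_F^k$ has $f_i(x^F)\le f_i(x)$ for all $i$, and $\psi(x)=-\min_{(x^F,\Delta)\in L_F^k}\sum_i[f_i(x)-\min\{f_i(x),f_i(x^F)\}]$ otherwise. Iteration $k$ is *dominating* if some $x^t\in V^{k+1}$ satisfies $h(x^t)=0$ and $x^t\prec_fx_F^k$, or $h(x^t)>0$ and $x^t\prec_hx_I^k$; *improving* if not dominating and some $x^t\in V^{k+1}$ satisfies $0<h(x^t)<h(x_I^k)$ and $f_{i_0}(x_I^k)<f_{i_0}(x^t)$ for some $i_0$; *unsuccessful* otherwise (clauses concerning a nonexistent center are dropped). New points get frame size $\tau^{-1}\Delta^k$ if they dominate a point of $F^k$ or $I^k$, or if they are feasible with $f_i\le\min_{F^k}f_i$ for all $i$ (one strict), or if $0<h\le\max_{I^k}h$ and $f_i\le\min_{I^k}f_i$ for all $i$ (one strict); otherwise they get $\Delta^k$. If the iteration is unsuccessful the frame size of each existing center becomes $\tau\Delta^k$. When $x_I^k$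 exists, $h^{k+1}_{\max}$ equals $\max_{x^t\in V^{k+1}}\{h(x^t):h(x^t)<h(x_I^k)\}$ if the iteration is improving; else $h(x_I^k)$ if $h(x_I^k)=\max_{x\in I^k}h(x)$; else $\max_{x^t\in V^{k+1}}\{h(x^t):h(x_I^k)\le h(x^t)<\max_{x\in I^k}h(x)\}$. Then the lists are updated by adding new nondominated points and removing dominated points and points above the threshold. **DMulti-MADS-TEB.** If $V^0$ contains no feasible point, a first phase runs single-objective MADS on $\min_{x\in\mathcal X}h(x)$ (frame center $x_I^k$ = a point of $V^k$ with smallest $h$ value, $I^k$ being the set of such points; the iteration is successful iff a point with strictly smaller $h$ is found, otherwise unsuccessful and the frame size is multiplied by $\tau$). As soon as a feasible point is found, the second phase uses only $L_F^k$: $f$ is replaced by $(+\infty,\dots,+\infty)^\top$ outside $\Omega$, only feasible centers are used, the iteration is successful iff a generated feasible point dominates $x_F^k$, otherwise unsuccessful and the frame size of $x_F^k$ is multiplied by $\tau$. **Refining notions.** Let $\mathbb U\subset\mathbb N$ be the set of indices of unsuccessful iterations. A subsequence $\{x^k\}_{k\in K}$ of frame centers around which the poll is executed, $K\subseteq\mathbb U$ infinite, is a *refining subsequence* if $\{\Delta^k\}_{k\in K}$ converges to $0$; its limit $\hat x$ is the *refining point*. It is *feasible* if its terms are the feasible frame centers $x_F^k$. A direction $d$ is a *refining direction* for $\hat x$ if there is an infinite $K'\subseteq K$ and $d^k\in\mathbb D^k_\Delta$ (poll directions used around $x^k$) with $x^k+\delta^kd^k\in\mathcal X$ for $k\in K'$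 and $d=\lim_{k\in K'}d^k/\|d^k\|$. (So refining directions are unit vectors.) Density hypothesis: every unit vector of $T^{Cl}_\Omega(\hat x_F)$ is a limit of refining directions for $\hat x_F$. **Nonsmooth notions.** $d\in\mathbb R^n$ is a Clarke tangent vector to $\Omega$ at $x\in\overline\Omega$ if for every sequence $y^k\in\Omega$ converging to $x$ and every sequence of positive reals $t^k\to0$ there are $w^k\to d$ with $y^k+t^kw^k\in\Omega$; the set of these is the Clarke tangent cone $T^{Cl}_\Omega(x)$. The hypertangent cone is $T^H_\Omega(x)=\{d\in\mathbb R^n:\exists\epsilon>0,\ y+tw\in\Omega\ \text{for all } y\in\Omega\cap B_\epsilon(x),\ w\in B_\epsilon(d),\ 0<t<\epsilon\}$, with $B_\epsilon$ open balls. "$f$ Lipschitz continuous near $\hat x$" means each $f_i$ is finite and Lipschitz on the intersection of $\mathcal X$ with some neighbourhood of $\hat x$. The Clarke–Jahn derivative is $f_i^o(x;d)=\limsup_{y\to x,\ y\in\mathcal X,\ t\searrow0,\ y+td\in\mathcal X}\frac{f_i(y+td)-f_i(y)}{t}$. *)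

theory Defs
  imports "HOL-Analysis.Analysis"
begin

section \<open>Problem, constraint violation and dominance\<close>

definition feasible_set ::
  "'a set \<Rightarrow> ('j \<Rightarrow> 'a \<Rightarrow> ereal) \<Rightarrow> 'j set \<Rightarrow> 'a set" where
  "feasible_set X c J = {x \<in> X. \<forall>j\<in>J. c j x \<le> 0}"

definition constraint_violation ::
  "'a set \<Rightarrow> ('j \<Rightarrow> 'a \<Rightarrow> ereal) \<Rightarrow> 'j set \<Rightarrow> 'a \<Rightarrow> ereal" where
  "constraint_violation X c J x = (if x \<in> X then \<Sum>j\<in>J. (max (c j x) 0)\<^sup>2 else \<infinity>)"

definition pareto_less :: "('m \<Rightarrow> 'a \<Rightarrow> ereal) \<Rightarrow> 'a \<Rightarrow> 'a \<Rightarrow> bool" where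
  "pareto_less f x y \<longleftrightarrow> (\<forall>i. f i x \<le> f i y) \<and> (\<exists>i. f i x < f i y)"

definition dominates_f :: "'a set \<Rightarrow> ('m \<Rightarrow> 'a \<Rightarrow> ereal) \<Rightarrow> 'a \<Rightarrow> 'a \<Rightarrow> bool" where
  "dominates_f \<Omega> f x y \<longleftrightarrow> x \<in> \<Omega> \<and> y \<in> \<Omega> \<and> pareto_less f x y"

definition dominates_h ::
  "'a set \<Rightarrow> 'a set \<Rightarrow> ('m \<Rightarrow> 'a \<Rightarrow> ereal) \<Rightarrow> ('a \<Rightarrow> ereal) \<Rightarrow> 'a \<Rightarrow> 'a \<Rightarrow> bool" where
  "dominates_h X \<Omega> f h x y \<longleftrightarrow> x \<in> X - \<Omega> \<and> y \<in> X - \<Omega>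
     \<and> (\<forall>i. f i x \<le> f i y) \<and> h x \<le> h y \<and> ((\<exists>i. f i x < f i y) \<or> h x < h y)"

definition undominated_feasible ::
  "'a set \<Rightarrow> ('m \<Rightarrow> 'a \<Rightarrow> ereal) \<Rightarrow> 'a set \<Rightarrow> 'a set" where
  "undominated_feasible \<Omega> f V = {x \<in> V \<inter> \<Omega>. \<not> (\<exists>y\<in>V \<inter> \<Omega>. dominates_f \<Omega> f y x)}"

definition extreme_barrier ::
  "'a set \<Rightarrow> ('m \<Rightarrow> 'a \<Rightarrow> ereal) \<Rightarrow> 'm \<Rightarrow> 'a \<Rightarrow> ereal" where
  "extreme_barrier \<Omega> f i x = (if x \<in> \<Omega> then f i x else \<infinity>)"

section \<open>Runs of the algorithm\<close>

definition positive_spanning_set :: "'a::real_vector set \<Rightarrow> bool" where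
  "positive_spanning_set S \<longleftrightarrow> finite S \<and>
     (\<forall>v. \<exists>a. (\<forall>s\<in>S. 0 \<le> a s) \<and> v = (\<Sum>s\<in>S. a s *\<^sub>R s))"

text \<open>
  A run of DMulti-MADS. For iteration \<open>k\<close>, \<open>evaluated k\<close> is $V^k$;
  \<open>frame_size k x\<close> is the frame size parameter attached to the evaluated point \<open>x\<close>
  (so the stored pairs are \<open>(x, frame_size k x)\<close>); the centers are \<open>None\<close> when they do not
  exist; \<open>frame k\<close> is $\Delta^k$; \<open>search_pts k\<close> and \<open>poll_pts k\<close> are the trial points actually
  treated in the search and in the poll; \<open>unsuccessful\<close> is $\mathbb U$; \<open>threshold\<close> is
  $h_{\max}$ and is used by the progressive barrier variant only.
\<close>

record 'a mads_run =
  evaluated :: "nat \<Rightarrow> 'a set"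
  frame_size :: "nat \<Rightarrow> 'a \<Rightarrow> real"
  feas_center :: "nat \<Rightarrow> ('a \<times> real) option"
  infeas_center :: "nat \<Rightarrow> ('a \<times> real) option"
  frame :: "nat \<Rightarrow> real"
  search_pts :: "nat \<Rightarrow> 'a set"
  poll_pts :: "nat \<Rightarrow> 'a set"
  feas_dirs :: "nat \<Rightarrow> 'a set"
  infeas_dirs :: "nat \<Rightarrow> 'a set"
  unsuccessful :: "nat set"
  threshold :: "nat \<Rightarrow> ereal"

definition mesh_size :: "'a mads_run \<Rightarrow> nat \<Rightarrow> real" where
  "mesh_size R k = min (frame R k) ((frame R k)\<^sup>2)"

definition centers :: "'a mads_run \<Rightarrow> nat \<Rightarrow> 'a set" where
  "centers R k = fst ` (set_option (feas_center R k) \<union> set_option (infeas_center R k))"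

text \<open>The poll directions used around \<open>x\<close> at iteration \<open>k\<close>; empty if \<open>x\<close> is not a frame center.\<close>

definition poll_dirs :: "'a mads_run \<Rightarrow> nat \<Rightarrow> 'a \<Rightarrow> 'a set" where
  "poll_dirs R k x =
     {d \<in> feas_dirs R k. x \<in> fst ` set_option (feas_center R k)} \<union>
     {d \<in> infeas_dirs R k. x \<in> fst ` set_option (infeas_center R k)}"

definition poll_set :: "'a::real_vector mads_run \<Rightarrow> nat \<Rightarrow> 'a set" where
  "poll_set R k = {x + mesh_size R k *\<^sub>R d | x d. x \<in> centers R k \<and> d \<in> poll_dirs R k x}"

definition mads_matrix :: "real^'n^'n \<Rightarrow> int^'d^'n \<Rightarrow> real^'d^'n" where
  "mads_matrix G Z = G ** (\<chi> i j. of_int (Z $ i $ j))"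

definition nat_combinations :: "real^'d^'n \<Rightarrow> (real^'n) set" where
  "nat_combinations D = {D *v (\<chi> j. of_nat (z $ j)) | z :: nat^'d. True}"

definition mesh :: "real^'d^'n \<Rightarrow> (real^'n) mads_run \<Rightarrow> nat \<Rightarrow> (real^'n) set" where
  "mesh D R k = (\<Union>x\<in>evaluated R k. {x + mesh_size R k *\<^sub>R v | v. v \<in> nat_combinations D})"

text \<open>The structure shared by both variants.\<close>

locale dmulti_mads =
  fixes X :: "(real^'n) set"
    and f :: "'m::finite \<Rightarrow> real^'n \<Rightarrow> ereal"
    and c :: "'j \<Rightarrow> real^'n \<Rightarrow> ereal"
    and J :: "'j set"
    and G :: "real^'n^'n"
    and Z :: "int^'d^'n"
    and \<tau> :: real
    and w :: nat
    and b :: real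
    and \<Delta>0 :: real
    and R :: "(real^'n) mads_run"
  assumes finite_J: "finite J"
    and f_not_MInf: "f i x \<noteq> -\<infinity>"
    and c_not_MInf: "j \<in> J \<Longrightarrow> c j x \<noteq> -\<infinity>"
    and G_invertible: "invertible G"
    and D_spanning: "positive_spanning_set (columns (mads_matrix G Z))"
    and tau: "0 < \<tau>" "\<tau> < 1" "\<tau> \<in> \<rat>"
    and Delta0_pos: "0 < \<Delta>0"
    and init_points: "finite (evaluated R 0)" "evaluated R 0 \<noteq> {}" "evaluated R 0 \<subseteq> X"
    and init_frame_size: "x \<in> evaluated R 0 \<Longrightarrow> frame_size R 0 x = \<Delta>0"
    and evaluated_Suc:
      "evaluated R (Suc k) = evaluated R k \<union> ((search_pts R k \<union> poll_pts R k) \<inter> X)"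
    and search: "finite (search_pts R k)" "search_pts R k \<subseteq> mesh (mads_matrix G Z) R k"
    and poll: "poll_pts R k \<subseteq> poll_set R k"
    and poll_complete: "k \<in> unsuccessful R \<Longrightarrow> poll_set R k \<inter> X \<subseteq> poll_pts R k"
    and some_center: "feas_center R k \<noteq> None \<or> infeas_center R k \<noteq> None"
    and feas_dirs: "finite (feas_dirs R k)"
      "feas_dirs R k \<subseteq> nat_combinations (mads_matrix G Z)"
      "d \<in> feas_dirs R k \<Longrightarrow> mesh_size R k * norm d \<le> b * frame R k"
    and infeas_dirs: "finite (infeas_dirs R k)"
      "infeas_dirs R k \<subseteq> nat_combinations (mads_matrix G Z)"
      "d \<in> infeas_dirs R k \<Longrightarrow> mesh_size R k * norm d \<le> b * frame R k"
    \<comment> \<open>the center named here is the primary one\<close>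
    and primary_center:
      "feas_center R k \<noteq> None \<and> positive_spanning_set (feas_dirs R k) \<or>
       infeas_center R k \<noteq> None \<and> positive_spanning_set (infeas_dirs R k)"
begin

abbreviation "\<Omega> \<equiv> feasible_set X c J"
abbreviation "h \<equiv> constraint_violation X c J"
abbreviation "F k \<equiv> undominated_feasible \<Omega> f (evaluated R k)"

definition LF :: "nat \<Rightarrow> ((real^'n) \<times> real) set" where
  "LF k = {(x, frame_size R k x) | x. x \<in> F k}"

definition feas_center_rule :: "nat \<Rightarrow> bool" where
  "feas_center_rule k \<longleftrightarrow>
     (feas_center R k = None \<longleftrightarrow> LF k = {}) \<and>
     (\<forall>x \<Delta>. feas_center R k = Some (x, \<Delta>) \<longrightarrow>
        (x, \<Delta>) \<in> LF k \<and> \<tau> ^ w * Max (snd ` LF k) \<le> \<Delta> \<and> \<Delta> \<le> Max (snd ` LF k))"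

definition frame_rule :: "nat \<Rightarrow> bool" where
  "frame_rule k \<longleftrightarrow>
     frame R k = (if LF k \<noteq> {} then snd (the (feas_center R k))
                  else snd (the (infeas_center R k)))"

end

subsection \<open>Progressive barrier\<close>

text \<open>Difference of extended reals with $\infty - \infty = 0$ (HOL has $\infty - \infty = \infty$).\<close>

definition ext_diff :: "ereal \<Rightarrow> ereal \<Rightarrow> ereal" where
  "ext_diff u v = (if u = v then 0 else u - v)"

definition psi ::
  "('m::finite \<Rightarrow> 'a \<Rightarrow> ereal) \<Rightarrow> ('a \<times> real) set \<Rightarrow> 'a \<Rightarrow> ereal" where
  "psi f L x =
     (if \<not> (\<exists>(y, \<Delta>)\<in>L. \<forall>i. f i y \<le> f i x)
      then Min ((\<lambda>(y, \<Delta>). \<Sum>i\<in>UNIV. ext_diff (f i y) (min (f i x) (f i y))) ` L)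
      else - Min ((\<lambda>(y, \<Delta>). \<Sum>i\<in>UNIV. ext_diff (f i x) (min (f i x) (f i y))) ` L))"

context dmulti_mads
begin

definition U :: "nat \<Rightarrow> (real^'n) set" where
  "U k = {x \<in> evaluated R k - \<Omega>. \<not> (\<exists>y\<in>evaluated R k - \<Omega>. dominates_h X \<Omega> f h y x)}"

definition I :: "nat \<Rightarrow> (real^'n) set" where
  "I k = (let W = {x \<in> U k. 0 < h x \<and> h x \<le> threshold R k}
          in {x \<in> W. \<not> (\<exists>y\<in>W. pareto_less f y x)})"

definition LI :: "nat \<Rightarrow> ((real^'n) \<times> real) set" where
  "LI k = {(x, frame_size R k x) | x. x \<in> I k}"

definition infeas_center_rule :: "nat \<Rightarrow> bool" where
  "infeas_center_rule k \<longleftrightarrow>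
     (infeas_center R k = None \<longleftrightarrow> LI k = {}) \<and>
     (\<forall>x \<Delta>. infeas_center R k = Some (x, \<Delta>) \<longrightarrow>
        (x, \<Delta>) \<in> LI k \<and>
        (LF k = {} \<longrightarrow>
           (\<exists>(y, \<Delta>')\<in>LI k. (\<forall>(u, \<Delta>'')\<in>LI k. h y \<le> h u) \<and> \<Delta>' \<le> \<Delta>)) \<and>
        (LF k \<noteq> {} \<longrightarrow> (\<forall>(u, \<Delta>'')\<in>LI k. psi f (LF k) u \<le> psi f (LF k) x)))"

definition dominating :: "nat \<Rightarrow> bool" where
  "dominating k \<longleftrightarrow> (\<exists>xt\<in>evaluated R (Suc k).
     (\<exists>x \<Delta>. feas_center R k = Some (x, \<Delta>) \<and> h xt = 0 \<and> dominates_f \<Omega> f xt x) \<or>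
     (\<exists>x \<Delta>. infeas_center R k = Some (x, \<Delta>) \<and> 0 < h xt \<and> dominates_h X \<Omega> f h xt x))"

definition improving :: "nat \<Rightarrow> bool" where
  "improving k \<longleftrightarrow> \<not> dominating k \<and> (\<exists>xt\<in>evaluated R (Suc k).
     \<exists>x \<Delta>. infeas_center R k = Some (x, \<Delta>) \<and> 0 < h xt \<and> h xt < h x \<and> (\<exists>i. f i x < f i xt))"

definition enlarges :: "nat \<Rightarrow> real^'n \<Rightarrow> bool" where
  "enlarges k x \<longleftrightarrow>
     (\<exists>y\<in>F k. dominates_f \<Omega> f x y) \<or>
     (\<exists>y\<in>I k. dominates_h X \<Omega> f h x y) \<or>
     (x \<in> \<Omega> \<and> F k \<noteq> {} \<and>
        (\<forall>i. f i x \<le> Min (f i ` F k)) \<and> (\<exists>i. f i x < Min (f i ` F k))) \<or>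
     (I k \<noteq> {} \<and> 0 < h x \<and> h x \<le> Max (h ` I k) \<and>
        (\<forall>i. f i x \<le> Min (f i ` I k)) \<and> (\<exists>i. f i x < Min (f i ` I k)))"

definition frame_size_rule_pb :: "nat \<Rightarrow> bool" where
  "frame_size_rule_pb k \<longleftrightarrow>
     (\<forall>x \<in> evaluated R (Suc k) - evaluated R k.
        frame_size R (Suc k) x = (if enlarges k x then inverse \<tau> * frame R k else frame R k)) \<and>
     (\<forall>x \<in> evaluated R k.
        frame_size R (Suc k) x =
          (if k \<in> unsuccessful R \<and> x \<in> centers R k then \<tau> * frame R k else frame_size R k x))"

definition threshold_rule :: "nat \<Rightarrow> bool" where
  "threshold_rule k \<longleftrightarrow> (\<forall>x \<Delta>. infeas_center R k = Some (x, \<Delta>) \<longrightarrow>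
     threshold R (Suc k) =
       (if improving k then Max {h xt | xt. xt \<in> evaluated R (Suc k) \<and> h xt < h x}
        else if h x = Max (h ` I k) then h x
        else Max {h xt | xt. xt \<in> evaluated R (Suc k) \<and> h x \<le> h xt \<and> h xt < Max (h ` I k)}))"

end

locale dmulti_mads_pb = dmulti_mads +
  assumes threshold_nonneg: "0 \<le> threshold R k"
    and feas_center: "feas_center_rule k"
    and infeas_center: "infeas_center_rule k"
    and frame: "frame_rule k"
    and unsuccessful_iff: "k \<in> unsuccessful R \<longleftrightarrow> \<not> dominating k \<and> \<not> improving k"
    and frame_size: "frame_size_rule_pb k"
    and threshold: "threshold_rule k"

subsection \<open>Two-phase extreme barrier\<close>

context dmulti_mads
begin

definition phase_one :: "nat \<Rightarrow> bool" where
  "phase_one k \<longleftrightarrow> evaluated R k \<inter> \<Omega> = {}"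

definition infeas_center_rule_teb :: "nat \<Rightarrow> bool" where
  "infeas_center_rule_teb k \<longleftrightarrow>
     (if phase_one k
      then \<exists>x\<in>evaluated R k. (\<forall>y\<in>evaluated R k. h x \<le> h y)
             \<and> infeas_center R k = Some (x, frame_size R k x)
      else infeas_center R k = None)"

definition successful_teb :: "nat \<Rightarrow> bool" where
  "successful_teb k \<longleftrightarrow>
     (if phase_one k
      then \<exists>xt\<in>evaluated R (Suc k). \<exists>x \<Delta>. infeas_center R k = Some (x, \<Delta>) \<and> h xt < h x
      else \<exists>xt\<in>evaluated R (Suc k). \<exists>x \<Delta>. feas_center R k = Some (x, \<Delta>)
             \<and> dominates_f \<Omega> (extreme_barrier \<Omega> f) xt x)"

text \<open>
  Single-objective MADS has one frame size, so in the first phase all points share it. After a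
  success, and for the new points of the second phase, the frame size may be kept or enlarged.
\<close>

definition frame_size_rule_teb :: "nat \<Rightarrow> bool" where
  "frame_size_rule_teb k \<longleftrightarrow>
     (if phase_one k
      then \<exists>\<Delta> \<in> (if k \<in> unsuccessful R then {\<tau> * frame R k}
                     else {frame R k, inverse \<tau> * frame R k}).
             \<forall>x\<in>evaluated R (Suc k). frame_size R (Suc k) x = \<Delta>
      else (\<forall>x \<in> evaluated R (Suc k) - evaluated R k.
              frame_size R (Suc k) x \<in> {frame R k, inverse \<tau> * frame R k}) \<and>
           (\<forall>x \<in> evaluated R k.
              frame_size R (Suc k) x =
                (if k \<in> unsuccessful R \<and> x \<in> centers R k then \<tau> * frame R k
                 else frame_size R k x)))"

end

locale dmulti_mads_teb = dmulti_mads +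
  assumes feas_center: "feas_center_rule k"
    and infeas_center: "infeas_center_rule_teb k"
    and frame: "frame_rule k"
    and unsuccessful_iff: "k \<in> unsuccessful R \<longleftrightarrow> \<not> successful_teb k"
    and frame_size: "frame_size_rule_teb k"

section \<open>Refining subsequences and directions\<close>

text \<open>Convergence of a subsequence: the limit is taken for \<open>k \<rightarrow> \<infinity>\<close> with \<open>k \<in> K\<close>.\<close>

abbreviation along :: "nat set \<Rightarrow> nat filter" where
  "along K \<equiv> inf sequentially (principal K)"

definition refining_subsequence ::
  "'a::real_normed_vector mads_run \<Rightarrow> nat set \<Rightarrow> (nat \<Rightarrow> 'a) \<Rightarrow> 'a \<Rightarrow> bool" where
  "refining_subsequence R K x xhat \<longleftrightarrow>
     infinite K \<and> K \<subseteq> unsuccessful R \<and> (\<forall>k\<in>K. x k \<in> centers R k) \<and>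
     (frame R \<longlongrightarrow> 0) (along K) \<and> (x \<longlongrightarrow> xhat) (along K)"

definition feasible_refining_subsequence ::
  "'a::real_normed_vector mads_run \<Rightarrow> nat set \<Rightarrow> (nat \<Rightarrow> 'a) \<Rightarrow> 'a \<Rightarrow> bool" where
  "feasible_refining_subsequence R K x xhat \<longleftrightarrow>
     refining_subsequence R K x xhat \<and> (\<forall>k\<in>K. \<exists>\<Delta>. feas_center R k = Some (x k, \<Delta>))"

definition refining_directions ::
  "'a::real_normed_vector set \<Rightarrow> 'a mads_run \<Rightarrow> nat set \<Rightarrow> (nat \<Rightarrow> 'a) \<Rightarrow> 'a set" where
  "refining_directions X R K x =
     {d. \<exists>K' dk. infinite K' \<and> K' \<subseteq> K \<and>
           (\<forall>k\<in>K'. dk k \<in> poll_dirs R k (x k) \<and> dk k \<noteq> 0 \<and> x k + mesh_size R k *\<^sub>R dk k \<in> X) \<and>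
           ((\<lambda>k. dk k /\<^sub>R norm (dk k)) \<longlongrightarrow> d) (along K')}"

section \<open>Nonsmooth notions\<close>

definition clarke_tangent_cone :: "'a::real_normed_vector set \<Rightarrow> 'a \<Rightarrow> 'a set" where
  "clarke_tangent_cone \<Omega> x =
     {d. x \<in> closure \<Omega> \<and>
         (\<forall>y t. (\<forall>k. y k \<in> \<Omega>) \<and> y \<longlonglongrightarrow> x \<and> (\<forall>k. 0 < t k) \<and> t \<longlonglongrightarrow> 0 \<longrightarrow>
            (\<exists>w. w \<longlonglongrightarrow> d \<and> (\<forall>k::nat. y k + (t k :: real) *\<^sub>R w k \<in> \<Omega>)))}"

definition hypertangent_cone :: "'a::real_normed_vector set \<Rightarrow> 'a \<Rightarrow> 'a set" where
  "hypertangent_cone \<Omega> x =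
     {d. \<exists>\<epsilon>>0. \<forall>y \<in> \<Omega> \<inter> ball x \<epsilon>. \<forall>w \<in> ball d \<epsilon>. \<forall>t. 0 < t \<and> t < \<epsilon> \<longrightarrow> y + t *\<^sub>R w \<in> \<Omega>}"

definition lipschitz_near ::
  "'a::real_normed_vector set \<Rightarrow> ('m \<Rightarrow> 'a \<Rightarrow> ereal) \<Rightarrow> 'a \<Rightarrow> bool" where
  "lipschitz_near X f x \<longleftrightarrow>
     (\<forall>i. \<exists>N L. open N \<and> x \<in> N \<and> (\<forall>y \<in> X \<inter> N. \<bar>f i y\<bar> \<noteq> \<infinity>) \<and>
        L-lipschitz_on (X \<inter> N) (\<lambda>y. real_of_ereal (f i y)))"

definition clarke_jahn_derivative ::
  "'a::real_normed_vector set \<Rightarrow> ('a \<Rightarrow> ereal) \<Rightarrow> 'a \<Rightarrow> 'a \<Rightarrow> ereal" where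
  "clarke_jahn_derivative X g x d =
     Limsup (inf (nhds x \<times>\<^sub>F at_right 0) (principal {(y, t). y \<in> X \<and> y + t *\<^sub>R d \<in> X}))
       (\<lambda>(y, t). (g (y + t *\<^sub>R d) - g y) / ereal t)"

definition pareto_clarke_critical ::
  "'a::real_normed_vector set \<Rightarrow> 'a set \<Rightarrow> ('m \<Rightarrow> 'a \<Rightarrow> ereal) \<Rightarrow> 'a \<Rightarrow> bool" where
  "pareto_clarke_critical X \<Omega> f x \<longleftrightarrow>
     (\<forall>d \<in> clarke_tangent_cone \<Omega> x. \<exists>i. 0 \<le> clarke_jahn_derivative X (f i) x d)"

end

(* Idea: an unsuccessful poll around the feasible center never finds a feasible point improving all
   objectives, so hypertangent refining directions carry difference quotients >= 0 for some
   objective, based at points of \<Omega>. For v Clarke tangent and u hypertangent, v + \<eta> u is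
   hypertangent, hence close to a multiple of a refining direction. Moving the base point y to
   y + t \<eta> u makes the step t v end at y + t (v + \<eta> u), which lies in \<Omega> as well, at a
   Lipschitz cost proportional to \<eta> t; so the quotients along v itself are at least -e for every
   e > 0. *)
theory Submission
  imports Defs
begin

section \<open>Tangent cones\<close>

text \<open>If no radius worked, counterexamples at the radii 1/(k+1) would form sequences to which
  the sequential definition applies, and the directions it supplies eventually enter
  \<open>ball v \<eta>\<close>. The gain is a radius valid for all base points and step lengths at
  once; only the direction \<open>w\<close> depends on them.\<close>

lemma clarke_tangent_uniform:
  assumes v: "v \<in> clarke_tangent_cone \<Omega> x" and "0 < \<eta>"
  obtains \<epsilon> where "0 < \<epsilon>"
    "\<And>y t. \<lbrakk>y \<in> \<Omega> \<inter> ball x \<epsilon>; 0 < t; t < \<epsilon>\<rbrakk> \<Longrightarrow> \<exists>w\<in>ball v \<eta>. y + t *\<^sub>R w \<in> \<Omega>"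
proof (rule ccontr)
  assume "\<not> thesis"
  then have "\<And>\<epsilon>. 0 < \<epsilon> \<Longrightarrow> \<exists>y t. y \<in> \<Omega> \<inter> ball x \<epsilon> \<and> 0 < t \<and> t < \<epsilon> \<and> \<not> (\<exists>w\<in>ball v \<eta>. y + t *\<^sub>R w \<in> \<Omega>)"
    using that by meson
  then have "\<forall>k. \<exists>y t. y \<in> \<Omega> \<inter> ball x (inverse (real (Suc k))) \<and> 0 < t \<and> t < inverse (real (Suc k))
      \<and> \<not> (\<exists>w\<in>ball v \<eta>. y + t *\<^sub>R w \<in> \<Omega>)"
    by (metis inverse_positive_iff_positive of_nat_0_less_iff zero_less_Suc)
  then obtain y t where yt: "\<And>k. y k \<in> \<Omega> \<inter> ball x (inverse (real (Suc k)))" "\<And>k. 0 < t k"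
      "\<And>k. t k < inverse (real (Suc k))" "\<And>k. \<not> (\<exists>w\<in>ball v \<eta>. y k + t k *\<^sub>R w \<in> \<Omega>)"
    by metis
  have "(\<lambda>k. dist (y k) x) \<longlonglongrightarrow> 0"
    using yt(1) by (intro real_tendsto_sandwich[OF _ _ tendsto_const LIMSEQ_inverse_real_of_nat])
      (auto simp: dist_commute intro!: always_eventually less_imp_le)
  then have "y \<longlonglongrightarrow> x" by (rule iffD2[OF tendsto_dist_iff])
  moreover have "t \<longlonglongrightarrow> 0"
    using yt(2,3) by (intro real_tendsto_sandwich[OF _ _ tendsto_const LIMSEQ_inverse_real_of_nat])
      (auto intro!: always_eventually less_imp_le)
  ultimately obtain w where w: "w \<longlonglongrightarrow> v" "\<And>k. y k + t k *\<^sub>R w k \<in> \<Omega>"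
    using v yt(1,2) unfolding clarke_tangent_cone_def by blast
  have "\<forall>\<^sub>F k in sequentially. w k \<in> ball v \<eta>"
    using w(1) \<open>0 < \<eta>\<close> by (simp add: tendsto_iff dist_commute)
  then obtain k where "w k \<in> ball v \<eta>"
    using eventually_happens by fastforce
  with w(2) yt(4) show False by blast
qed

text \<open>A step along \<open>w\<close> near \<open>v + u\<close> is taken in two legs: first
  along some \<open>w'\<close> near \<open>v\<close>, where Clarke tangency stays in \<Omega>, then
  along \<open>w - w'\<close>, which is near \<open>u\<close> and so is covered by
  hypertangency.\<close>

lemma clarke_tangent_plus_hypertangent:
  assumes v: "v \<in> clarke_tangent_cone \<Omega> x" and u: "u \<in> hypertangent_cone \<Omega> x"
  shows "v + u \<in> hypertangent_cone \<Omega> x"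
proof -
  obtain \<epsilon> where \<epsilon>: "0 < \<epsilon>"
    "\<And>y w t. \<lbrakk>y \<in> \<Omega> \<inter> ball x \<epsilon>; w \<in> ball u \<epsilon>; 0 < t; t < \<epsilon>\<rbrakk> \<Longrightarrow> y + t *\<^sub>R w \<in> \<Omega>"
    using u unfolding hypertangent_cone_def by blast
  define \<eta> where "\<eta> = \<epsilon> / 2"
  have "0 < \<eta>" using \<epsilon>(1) by (simp add: \<eta>_def)
  then obtain \<rho> where \<rho>: "0 < \<rho>"
    "\<And>y t. \<lbrakk>y \<in> \<Omega> \<inter> ball x \<rho>; 0 < t; t < \<rho>\<rbrakk> \<Longrightarrow> \<exists>w\<in>ball v \<eta>. y + t *\<^sub>R w \<in> \<Omega>"
    using clarke_tangent_uniform[OF v] by metis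
  \<comment> \<open>\<open>M\<close> bounds the norm of every \<open>w'\<close> in
    \<open>ball v \<eta>\<close>, so the cap \<open>\<eta> / M\<close> on \<open>r\<close> keeps the
    first leg no longer than \<eta>. The cap \<eta> keeps both the base point and \<open>w\<close>
    within the other half of \<epsilon>.\<close>
  define M where "M = norm v + \<eta>"
  have M: "0 < M" using \<open>0 < \<eta>\<close> by (simp add: M_def add_nonneg_pos)
  define r where "r = min (min \<rho> \<epsilon>) (min \<eta> (\<eta> / M))"
  have r: "0 < r" "r \<le> \<rho>" "r \<le> \<epsilon>" "r \<le> \<eta>" "r \<le> \<eta> / M"
    using \<open>0 < \<eta>\<close> M \<rho>(1) \<epsilon>(1) by (auto simp: r_def)
  have "y + t *\<^sub>R w \<in> \<Omega>"
    if y: "y \<in> \<Omega> \<inter> ball x r" and w: "w \<in> ball (v + u) r" and t: "0 < t" "t < r" for y w t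
  proof -
    obtain w' where w': "w' \<in> ball v \<eta>" "y + t *\<^sub>R w' \<in> \<Omega>"
      using \<rho>(2)[of y t] y t r by auto
    have "norm w' \<le> M"
      using w'(1) norm_triangle_ineq2[of w' v] by (simp add: M_def dist_norm norm_minus_commute)
    then have "t * norm w' \<le> r * M" using t by (intro mult_mono) auto
    also have "\<dots> \<le> \<eta>" using r(5) M by (simp add: field_simps)
    finally have "norm (t *\<^sub>R w') \<le> \<eta>" using t by simp
    moreover have "norm (x - y) < \<eta>" using y r by (simp add: dist_norm)
    ultimately have "y + t *\<^sub>R w' \<in> ball x \<epsilon>"
      using norm_triangle_ineq4[of "x - y" "t *\<^sub>R w'"] by (simp add: dist_norm \<eta>_def diff_diff_eq)
    moreover have "w - w' \<in> ball u \<epsilon>"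
    proof -
      have "u - (w - w') = (v + u - w) - (v - w')" by simp
      also have "norm \<dots> \<le> norm (v + u - w) + norm (v - w')" by (rule norm_triangle_ineq4)
      also have "\<dots> < \<epsilon>" using w w'(1) r(4) by (simp add: dist_norm \<eta>_def)
      finally show ?thesis by (simp add: dist_norm)
    qed
    ultimately have "(y + t *\<^sub>R w') + t *\<^sub>R (w - w') \<in> \<Omega>"
      using \<epsilon>(2) w'(2) t r by auto
    then show ?thesis by (simp add: algebra_simps)
  qed
  with r(1) show ?thesis unfolding hypertangent_cone_def by blast
qed

lemma hypertangent_scaleR:
  assumes u: "u \<in> hypertangent_cone \<Omega> x" and "0 < a"
  shows "a *\<^sub>R u \<in> hypertangent_cone \<Omega> x"
proof -
  obtain \<epsilon> where \<epsilon>: "0 < \<epsilon>"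
    "\<And>y w t. \<lbrakk>y \<in> \<Omega> \<inter> ball x \<epsilon>; w \<in> ball u \<epsilon>; 0 < t; t < \<epsilon>\<rbrakk> \<Longrightarrow> y + t *\<^sub>R w \<in> \<Omega>"
    using u unfolding hypertangent_cone_def by blast
  \<comment> \<open>The step is rewritten as \<open>t * a\<close> along
    \<open>w /\<^sub>R a\<close>: the cap \<open>a * \<epsilon>\<close> puts the rescaled direction
    near \<open>u\<close>, and \<open>\<epsilon> / a\<close> keeps the rescaled step length below
    \<epsilon>.\<close>
  define r where "r = min \<epsilon> (min (a * \<epsilon>) (\<epsilon> / a))"
  have r: "0 < r" "r \<le> \<epsilon>" "r \<le> a * \<epsilon>" "r \<le> \<epsilon> / a"
    using \<epsilon>(1) \<open>0 < a\<close> by (auto simp: r_def)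
  have "y + t *\<^sub>R w \<in> \<Omega>"
    if y: "y \<in> \<Omega> \<inter> ball x r" and w: "w \<in> ball (a *\<^sub>R u) r" and t: "0 < t" "t < r" for y w t
  proof -
    have "u - w /\<^sub>R a = (a *\<^sub>R u - w) /\<^sub>R a"
      using \<open>0 < a\<close> by (simp add: algebra_simps)
    then have "norm (u - w /\<^sub>R a) = norm (a *\<^sub>R u - w) / a"
      using \<open>0 < a\<close> by (simp add: divide_inverse mult.commute)
    also have "\<dots> < \<epsilon>"
      using w r(3) \<open>0 < a\<close> by (simp add: dist_norm divide_less_eq mult.commute)
    finally have "w /\<^sub>R a \<in> ball u \<epsilon>" by (simp add: dist_norm)
    moreover have "t * a < \<epsilon>" using t r(4) \<open>0 < a\<close> by (simp add: pos_le_divide_eq)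
        (meson \<open>0 < a\<close> mult_strict_right_mono order_less_le_trans)
    ultimately have "y + (t * a) *\<^sub>R (w /\<^sub>R a) \<in> \<Omega>"
      using y r(2) t \<open>0 < a\<close> by (intro \<epsilon>(2)) auto
    moreover have "(t * a) *\<^sub>R (w /\<^sub>R a) = t *\<^sub>R w" using \<open>0 < a\<close> by (simp add: field_simps)
    ultimately show ?thesis by metis
  qed
  with r(1) show ?thesis unfolding hypertangent_cone_def by blast
qed

text \<open>The sequence that is eventually constant \<open>u\<close> witnesses tangency. The
  inclusion lets a density hypothesis on the Clarke cone be applied to hypertangent
  directions.\<close>

lemma hypertangent_subset_clarke_tangent:
  assumes "x \<in> closure \<Omega>"
  shows "hypertangent_cone \<Omega> x \<subseteq> clarke_tangent_cone \<Omega> x"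
proof
  fix u assume "u \<in> hypertangent_cone \<Omega> x"
  then obtain \<epsilon> where \<epsilon>: "0 < \<epsilon>"
    "\<And>y w t. \<lbrakk>y \<in> \<Omega> \<inter> ball x \<epsilon>; w \<in> ball u \<epsilon>; 0 < t; t < \<epsilon>\<rbrakk> \<Longrightarrow> y + t *\<^sub>R w \<in> \<Omega>"
    unfolding hypertangent_cone_def by blast
  have "\<exists>w. w \<longlonglongrightarrow> u \<and> (\<forall>k::nat. y k + t k *\<^sub>R w k \<in> \<Omega>)"
    if y: "\<forall>k. y k \<in> \<Omega>" "y \<longlonglongrightarrow> x" and t: "\<forall>k. 0 < t k" "t \<longlonglongrightarrow> 0" for y and t :: "nat \<Rightarrow> real"
  proof (intro exI conjI allI)
    \<comment> \<open>the tangency condition also constrains the first terms, where 0 is the safe choice\<close>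
    let ?w = "\<lambda>k. if y k + t k *\<^sub>R u \<in> \<Omega> then u else 0"
    have "\<forall>\<^sub>F k in sequentially. y k \<in> ball x \<epsilon>"
      using y(2) \<epsilon>(1) by (simp add: tendsto_iff dist_commute)
    moreover have "\<forall>\<^sub>F k in sequentially. t k < \<epsilon>"
      using t(2) \<epsilon>(1) by (rule order_tendstoD)
    ultimately have "\<forall>\<^sub>F k in sequentially. ?w k = u"
      by eventually_elim (use \<epsilon> y t in auto)
    then show "?w \<longlonglongrightarrow> u" by (rule tendsto_eventually)
    show "y k + t k *\<^sub>R ?w k \<in> \<Omega>" for k using y(1) by simp
  qed
  with assms show "u \<in> clarke_tangent_cone \<Omega> x" unfolding clarke_tangent_cone_def by blast
qed

section \<open>A sufficient condition for Pareto-Clarke criticality\<close>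

lemma lipschitz_near_uniform:
  fixes f :: "'m::finite \<Rightarrow> 'a::real_normed_vector \<Rightarrow> ereal"
  assumes "lipschitz_near X f x"
  obtains \<rho> L where "0 < \<rho>" "0 \<le> L"
    "\<And>i y. y \<in> X \<inter> ball x \<rho> \<Longrightarrow> \<bar>f i y\<bar> \<noteq> \<infinity>"
    "\<And>i y z. y \<in> X \<inter> ball x \<rho> \<Longrightarrow> z \<in> X \<inter> ball x \<rho> \<Longrightarrow>
       \<bar>real_of_ereal (f i y) - real_of_ereal (f i z)\<bar> \<le> L * dist y z"
proof -
  obtain N L where N: "\<And>i. open (N i)" "\<And>i. x \<in> N i" "\<And>i y. y \<in> X \<inter> N i \<Longrightarrow> \<bar>f i y\<bar> \<noteq> \<infinity>"
    and L: "\<And>i. (L i)-lipschitz_on (X \<inter> N i) (\<lambda>y. real_of_ereal (f i y))"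
    using assms unfolding lipschitz_near_def by metis
  have "open (\<Inter>i. N i)" "x \<in> (\<Inter>i. N i)" using N by auto
  then obtain \<rho> where \<rho>: "0 < \<rho>" "ball x \<rho> \<subseteq> (\<Inter>i. N i)"
    by (rule openE)
  have L0: "0 \<le> L i" for i using L lipschitz_on_nonneg by blast
  show thesis
  \<comment> \<open>All \<open>L i\<close> are nonnegative, so their sum is a common Lipschitz
    constant.\<close>
  proof (rule that[of \<rho> "\<Sum>i\<in>UNIV. L i"])
    fix i y z assume yz: "y \<in> X \<inter> ball x \<rho>" "z \<in> X \<inter> ball x \<rho>"
    then have "y \<in> X \<inter> N i" "z \<in> X \<inter> N i" using \<rho>(2) by auto
    from lipschitz_onD[OF L this]
    have "\<bar>real_of_ereal (f i y) - real_of_ereal (f i z)\<bar> \<le> L i * dist y z"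
      by (simp add: dist_real_def)
    also have "\<dots> \<le> (\<Sum>i\<in>UNIV. L i) * dist y z"
      using L0 by (intro mult_right_mono member_le_sum) auto
    finally show "\<bar>real_of_ereal (f i y) - real_of_ereal (f i z)\<bar> \<le> (\<Sum>i\<in>UNIV. L i) * dist y z" .
  next
    fix i y assume "y \<in> X \<inter> ball x \<rho>"
    then show "\<bar>f i y\<bar> \<noteq> \<infinity>" using \<rho>(2) by (intro N(3)) auto
  qed (use \<rho> L0 in \<open>auto intro!: sum_nonneg\<close>)
qed

text \<open>Quantitative failure of criticality: strict negativity of each limsup leaves room for a
  negative bound on the nearby quotients, and finiteness of the index type makes the bound and the
  radius common to all objectives.\<close>

lemma clarke_jahn_derivative_all_neg:
  fixes f :: "'m::finite \<Rightarrow> 'a::real_normed_vector \<Rightarrow> ereal"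
  assumes "\<And>i. clarke_jahn_derivative X (f i) x v < 0"
  obtains e r where "0 < e" "0 < r"
    "\<And>i y t. \<lbrakk>y \<in> X \<inter> ball x r; 0 < t; t < r; y + t *\<^sub>R v \<in> X\<rbrakk> \<Longrightarrow>
       (f i (y + t *\<^sub>R v) - f i y) / ereal t < ereal (- e)"
proof -
  let ?P = "principal {(y, t). y \<in> X \<and> y + t *\<^sub>R v \<in> X}"
  \<comment> \<open>The bound is a real number even where the derivative is
    \<open>-\<infinity>\<close>.\<close>
  have "\<exists>C<0. clarke_jahn_derivative X (f i) x v < ereal C" for i
    using ereal_dense2[OF assms[of i]] by auto
  then obtain C where C: "\<And>i. C i < 0" "\<And>i. clarke_jahn_derivative X (f i) x v < ereal (C i)"
    by metis
  define e where "e = Min (range (\<lambda>i. - C i))"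
  have e: "0 < e" using C(1) by (auto simp: e_def)
  have Ce: "C i \<le> - e" for i
  proof -
    have "e \<le> - C i" unfolding e_def by (rule Min_le) auto
    then show ?thesis by linarith
  qed
  have "\<forall>\<^sub>F (y, t) in inf (nhds x \<times>\<^sub>F at_right 0) ?P.
      (f i (y + t *\<^sub>R v) - f i y) / ereal t < ereal (C i)" for i
    using Limsup_lessD[OF C(2)[of i, unfolded clarke_jahn_derivative_def]]
    by eventually_elim auto
  then have "\<forall>\<^sub>F p in inf (nhds x \<times>\<^sub>F at_right 0) ?P. \<forall>i. case p of (y, t) \<Rightarrow>
      (f i (y + t *\<^sub>R v) - f i y) / ereal t < ereal (C i)"
    by (intro eventually_all_finite)
  then obtain P Q where P: "eventually P (nhds x)" and Q: "eventually Q (at_right (0::real))"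
    and PQ: "\<And>y t i. \<lbrakk>P y; Q t; y \<in> X; y + t *\<^sub>R v \<in> X\<rbrakk> \<Longrightarrow>
      (f i (y + t *\<^sub>R v) - f i y) / ereal t < ereal (C i)"
    unfolding eventually_inf_principal eventually_prod_filter by auto
  obtain r1 where r1: "0 < r1" "\<And>y. dist y x < r1 \<Longrightarrow> P y"
    using P unfolding eventually_nhds_metric by blast
  obtain r2 where r2: "0 < r2" "\<And>t. 0 < t \<Longrightarrow> t < r2 \<Longrightarrow> Q t"
    using Q unfolding eventually_at_right_field by auto
  show thesis
  proof (rule that[of e "min r1 r2"])
    fix i y t assume "y \<in> X \<inter> ball x (min r1 r2)" "0 < t" "t < min r1 r2" "y + t *\<^sub>R v \<in> X"
    then have "(f i (y + t *\<^sub>R v) - f i y) / ereal t < ereal (C i)"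
      by (intro PQ r1 r2) (auto simp: dist_commute)
    also have "\<dots> \<le> ereal (- e)" using Ce by simp
    finally show "(f i (y + t *\<^sub>R v) - f i y) / ereal t < ereal (- e)" .
  qed (use e r1 r2 in auto)
qed

text \<open>The analytic half, free of the algorithm: \<open>no_descent\<close> is all that the
  polls have to supply. Its index \<open>i\<close> may change with \<open>r\<close>; this is
  harmless because the assumed descent along \<open>v\<close> is uniform over all
  objectives.\<close>

lemma pareto_clarke_critical_if_no_descent:
  fixes f :: "'m::finite \<Rightarrow> 'a::real_normed_vector \<Rightarrow> ereal"
  assumes sub: "\<Omega> \<subseteq> X" and x: "x \<in> X" and lip: "lipschitz_near X f x"
    and u: "u \<in> hypertangent_cone \<Omega> x"
    and no_descent: "\<And>w r. \<lbrakk>w \<in> hypertangent_cone \<Omega> x; norm w = 1; 0 < r\<rbrakk> \<Longrightarrow>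
      \<exists>y s w' i. y \<in> \<Omega> \<inter> ball x r \<and> 0 < s \<and> s < r \<and> w' \<in> ball w r \<and> y + s *\<^sub>R w' \<in> \<Omega>
        \<and> f i y \<le> f i (y + s *\<^sub>R w')"
  shows "pareto_clarke_critical X \<Omega> f x"
  unfolding pareto_clarke_critical_def
proof (intro ballI, rule ccontr)
  fix v assume v: "v \<in> clarke_tangent_cone \<Omega> x"
    and "\<not> (\<exists>i. 0 \<le> clarke_jahn_derivative X (f i) x v)"
  then have "\<And>i. clarke_jahn_derivative X (f i) x v < 0" by (simp add: not_le)
  then obtain e r where e: "0 < e" and r: "0 < r"
    and er: "\<And>i y t. \<lbrakk>y \<in> X \<inter> ball x r; 0 < t; t < r; y + t *\<^sub>R v \<in> X\<rbrakk> \<Longrightarrow>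
       (f i (y + t *\<^sub>R v) - f i y) / ereal t < ereal (- e)"
    using clarke_jahn_derivative_all_neg by metis
  obtain \<rho> L where \<rho>: "0 < \<rho>" and L: "0 \<le> L"
    and fin: "\<And>i y. y \<in> X \<inter> ball x \<rho> \<Longrightarrow> \<bar>f i y\<bar> \<noteq> \<infinity>"
    and lipL: "\<And>i y z. y \<in> X \<inter> ball x \<rho> \<Longrightarrow> z \<in> X \<inter> ball x \<rho> \<Longrightarrow>
       \<bar>real_of_ereal (f i y) - real_of_ereal (f i z)\<bar> \<le> L * dist y z"
    using lipschitz_near_uniform[OF lip] by metis
  have quotient: "real_of_ereal (f i (y + t *\<^sub>R v)) - real_of_ereal (f i y) < - e * t"
    if "y \<in> X \<inter> ball x r" "y \<in> ball x \<rho>" "0 < t" "t < r" "y + t *\<^sub>R v \<in> X \<inter> ball x \<rho>" for i y t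
  proof -
    have "\<bar>f i (y + t *\<^sub>R v)\<bar> \<noteq> \<infinity>" "\<bar>f i y\<bar> \<noteq> \<infinity>" using fin that by auto
    then obtain p q where pq: "f i (y + t *\<^sub>R v) = ereal p" "f i y = ereal q"
      by (cases "f i (y + t *\<^sub>R v)"; cases "f i y") auto
    have "(f i (y + t *\<^sub>R v) - f i y) / ereal t < ereal (- e)" using that by (intro er) auto
    then have "(p - q) / t < - e" using that(3) by (simp add: pq)
    then show ?thesis using that(3) by (simp add: pq pos_divide_less_eq)
  qed
  show False
  proof (cases "v = 0")
    \<comment> \<open>Here the quotient vanishes. The case is split off because
      \<open>v + \<eta> *\<^sub>R u \<noteq> 0\<close> for small \<eta> is deduced from
      \<open>v \<noteq> 0\<close>.\<close>
    case True
    have "0 < - e * (r / 2)" using quotient[of x "r / 2"] True x r \<rho> by simp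
    moreover have "0 < e * (r / 2)" using e r by simp
    ultimately show False by simp
  next
    case False
    have "((\<lambda>\<eta>. L * \<eta> * norm u) \<longlongrightarrow> 0) (at_right 0)" "((\<lambda>\<eta>. v + \<eta> *\<^sub>R u) \<longlongrightarrow> v) (at_right 0)"
      by (auto intro!: tendsto_eq_intros)
    \<comment> \<open>Moving the base point by \<open>t *\<^sub>R (\<eta> *\<^sub>R u)\<close> will
      cost at most \<open>L * t * \<eta> * norm u\<close>; this choice of \<eta> makes that less
      than half of the assumed decrease \<open>e * t\<close>.\<close>
    then have "\<forall>\<^sub>F \<eta> in at_right 0. 0 < \<eta> \<and> L * \<eta> * norm u < e / 2 \<and> v + \<eta> *\<^sub>R u \<noteq> 0"
      using e False
      by (intro eventually_conj eventually_at_right_less order_tendstoD(2)[where y = 0 and a = "e / 2"]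
          tendsto_imp_eventually_ne) auto
    from eventually_happens'[OF trivial_limit_at_right_real this] obtain \<eta> where \<eta>: "0 < \<eta>" "L * \<eta> * norm u < e / 2" "v + \<eta> *\<^sub>R u \<noteq> 0" by blast
    define w where "w = v + \<eta> *\<^sub>R u"
    define a where "a = norm w"
    have a: "0 < a" using \<eta>(3) by (simp add: a_def w_def)
    have uH: "\<eta> *\<^sub>R u \<in> hypertangent_cone \<Omega> x" by (rule hypertangent_scaleR[OF u \<eta>(1)])
    have wH: "w \<in> hypertangent_cone \<Omega> x"
      unfolding w_def by (rule clarke_tangent_plus_hypertangent[OF v uH])
    obtain \<epsilon>1 where \<epsilon>1: "0 < \<epsilon>1"
      "\<And>y t. \<lbrakk>y \<in> \<Omega> \<inter> ball x \<epsilon>1; 0 < t; t < \<epsilon>1\<rbrakk> \<Longrightarrow> y + t *\<^sub>R (\<eta> *\<^sub>R u) \<in> \<Omega>"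
      using uH unfolding hypertangent_cone_def by (auto simp del: scaleR_scaleR)
    obtain \<epsilon>2 where \<epsilon>2: "0 < \<epsilon>2"
      "\<And>y t. \<lbrakk>y \<in> \<Omega> \<inter> ball x \<epsilon>2; 0 < t; t < \<epsilon>2\<rbrakk> \<Longrightarrow> y + t *\<^sub>R w \<in> \<Omega>"
      using wH unfolding hypertangent_cone_def by auto
    define m where "m = min (min r \<rho>) (min \<epsilon>1 \<epsilon>2)"
    have m: "0 < m" "m \<le> r" "m \<le> \<rho>" "m \<le> \<epsilon>1" "m \<le> \<epsilon>2"
      using r \<rho> \<epsilon>1(1) \<epsilon>2(1) by (auto simp: m_def)
    have "((\<lambda>s. s + s * (1 + s)) \<longlongrightarrow> 0 + 0 * (1 + 0)) (at_right (0::real))"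
      by (intro tendsto_intros)
    moreover have "((\<lambda>s. s + s / a * norm (\<eta> *\<^sub>R u)) \<longlongrightarrow> 0) (at_right 0)"
      "((\<lambda>s. s / a) \<longlongrightarrow> 0) (at_right 0)" "((\<lambda>s. L * (a * s)) \<longlongrightarrow> 0) (at_right 0)"
      using a by (auto intro!: tendsto_eq_intros)
    \<comment> \<open>The bounds on \<open>s\<close> serve in turn to keep
      \<open>y + s *\<^sub>R w'\<close> and \<open>y + t *\<^sub>R w\<close> in
      \<open>ball x m\<close>, to keep the shifted base point there, to make \<open>t\<close> an
      admissible step length, and to charge the replacement of \<open>w'\<close> by
      \<open>w /\<^sub>R a\<close> to the other half of \<open>e * t\<close>.\<close>
    ultimately have "\<forall>\<^sub>F s in at_right 0. 0 < s \<and> s + s * (1 + s) < m \<and> s + s / a * norm (\<eta> *\<^sub>R u) < m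
        \<and> s / a < m \<and> L * (a * s) < e / 2"
      using e m(1) by (intro eventually_conj eventually_at_right_less order_tendstoD(2)[where y = 0]) auto
    from eventually_happens'[OF trivial_limit_at_right_real this] obtain q where q: "0 < q" "q + q * (1 + q) < m" "q + q / a * norm (\<eta> *\<^sub>R u) < m"
        "q / a < m" "L * (a * q) < e / 2" by blast
    have "w /\<^sub>R a \<in> hypertangent_cone \<Omega> x" "norm (w /\<^sub>R a) = 1"
      using hypertangent_scaleR[OF wH, of "inverse a"] a by (auto simp: a_def)
    from no_descent[OF this q(1)] obtain y s w' i where y: "y \<in> \<Omega>" "dist x y < q" and s: "0 < s" "s < q"
      and w': "dist (w /\<^sub>R a) w' < q" and yw': "y + s *\<^sub>R w' \<in> \<Omega>" and fi: "f i y \<le> f i (y + s *\<^sub>R w')"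
      by auto
    \<comment> \<open>A step of length \<open>s\<close> along the unit vector
      \<open>w /\<^sub>R a\<close> is a step \<open>t\<close> along \<open>w\<close>.\<close>
    define t where "t = s / a"
    have t: "0 < t" "t < q / a" using s a by (auto simp: t_def divide_strict_right_mono)
    have qq: "q < q * (1 + q)" using q(1) by (simp add: distrib_left)
    have qm: "q < m" using q(1,2) qq by linarith
    define y' where "y' = y + t *\<^sub>R (\<eta> *\<^sub>R u)"
    have y'v: "y' + t *\<^sub>R v = y + t *\<^sub>R w" by (simp add: y'_def w_def algebra_simps)
    \<comment> \<open>Both ends of the difference quotient along \<open>v\<close> lie in \<Omega>:
      \<open>y'\<close> because \<open>\<eta> *\<^sub>R u\<close> is hypertangent, and
      \<open>y + t *\<^sub>R w\<close> because \<open>w\<close> is.\<close>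
    have y'\<Omega>: "y' \<in> \<Omega>" unfolding y'_def using \<epsilon>1(2)[of y t] y t q(4) qm m by auto
    have yw: "y + t *\<^sub>R w \<in> \<Omega>" using \<epsilon>2(2)[of y t] y t q(4) qm m by auto
    have near: "y + z \<in> ball x m" if "q + norm z < m" for z
    proof -
      have "dist x (y + z) \<le> dist x y + norm z"
        using dist_triangle[of x "y + z" y] by (simp add: dist_norm)
      with that y(2) show ?thesis by simp
    qed
    have y'b: "y' \<in> ball x m" unfolding y'_def
    proof (rule near)
      have "norm (t *\<^sub>R \<eta> *\<^sub>R u) = t * norm (\<eta> *\<^sub>R u)" using t by (simp add: abs_mult)
      also have "\<dots> \<le> q / a * norm (\<eta> *\<^sub>R u)" using t by (intro mult_right_mono) auto
      finally show "q + norm (t *\<^sub>R \<eta> *\<^sub>R u) < m" using q(3) by linarith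
    qed
    have tw: "norm (t *\<^sub>R w) = s" using a s by (simp add: t_def a_def)
    have ywb: "y + t *\<^sub>R w \<in> ball x m"
    proof (rule near)
      have "s < q * (1 + q)" using s qq by linarith
      then show "q + norm (t *\<^sub>R w) < m" unfolding tw using q(2) by linarith
    qed
    have yw'b: "y + s *\<^sub>R w' \<in> ball x m"
    proof (rule near)
      have "norm w' \<le> norm (w /\<^sub>R a) + dist (w /\<^sub>R a) w'"
        by (metis add.commute dist_commute dist_norm norm_triangle_sub)
      then have "norm w' \<le> 1 + q" using w' \<open>norm (w /\<^sub>R a) = 1\<close> by linarith
      then have "s * norm w' \<le> q * (1 + q)" using s by (intro mult_mono) auto
      then show "q + norm (s *\<^sub>R w') < m" using q(2) s(1) by simp
    qed
    have yb: "y \<in> ball x m" using y(2) qm by simp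
    \<comment> \<open>Of the facts collected below, the first says that \<open>?g\<close> drops by
      more than \<open>e * t\<close> from \<open>y'\<close> to \<open>y + t *\<^sub>R w\<close>. It
      does not drop from \<open>y\<close> to \<open>y + s *\<^sub>R w'\<close>, and the two
      Lipschitz corrections cost at most \<open>t * (e / 2)\<close> each, a contradiction.\<close>
    let ?g = "\<lambda>y. real_of_ereal (f i y)"
    have "?g (y + t *\<^sub>R w) - ?g y' < - e * t"
      using quotient[of y' t] y'v y'\<Omega> yw y'b ywb m t q(4) sub by auto
    moreover have "?g y \<le> ?g (y + s *\<^sub>R w')"
    proof -
      have "\<bar>f i y\<bar> \<noteq> \<infinity>" "\<bar>f i (y + s *\<^sub>R w')\<bar> \<noteq> \<infinity>"
        using y yw' yb yw'b m sub by (intro fin; auto)+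
      with fi show ?thesis by (cases "f i y"; cases "f i (y + s *\<^sub>R w')") auto
    qed
    moreover have "\<bar>?g y - ?g y'\<bar> \<le> L * (t * (\<eta> * norm u))"
    proof -
      have "dist y y' = t * (\<eta> * norm u)" using t \<eta>(1) by (simp add: y'_def dist_norm abs_mult)
      moreover have "\<bar>?g y - ?g y'\<bar> \<le> L * dist y y'"
        using y y'\<Omega> yb y'b m sub by (intro lipL) auto
      ultimately show ?thesis by simp
    qed
    moreover have "\<bar>?g (y + s *\<^sub>R w') - ?g (y + t *\<^sub>R w)\<bar> \<le> L * (s * q)"
    proof -
      have "t *\<^sub>R w = s *\<^sub>R (w /\<^sub>R a)" by (simp add: t_def divide_inverse)
      then have "(y + s *\<^sub>R w') - (y + t *\<^sub>R w) = s *\<^sub>R (w' - w /\<^sub>R a)"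
        by (simp only: scaleR_diff_right add_diff_cancel_left)
      then have "dist (y + s *\<^sub>R w') (y + t *\<^sub>R w) = s * dist (w /\<^sub>R a) w'"
        using s(1) by (simp only: dist_norm norm_scaleR abs_of_pos norm_minus_commute)
      also have "\<dots> \<le> s * q" using w' s by (intro mult_left_mono) auto
      finally have "L * dist (y + s *\<^sub>R w') (y + t *\<^sub>R w) \<le> L * (s * q)"
        using L by (rule mult_left_mono)
      moreover have "\<bar>?g (y + s *\<^sub>R w') - ?g (y + t *\<^sub>R w)\<bar> \<le> L * dist (y + s *\<^sub>R w') (y + t *\<^sub>R w)"
        using yw yw' ywb yw'b m sub by (intro lipL) auto
      ultimately show ?thesis by linarith
    qed
    moreover have "L * (t * (\<eta> * norm u)) \<le> t * (e / 2)"
      using mult_left_mono[OF less_imp_le[OF \<eta>(2)], of t] t by (simp add: mult_ac)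
    moreover have "L * (s * q) \<le> t * (e / 2)"
    proof -
      have "s = t * a" using a by (simp add: t_def)
      then show ?thesis using mult_left_mono[OF less_imp_le[OF q(5)], of t] t by (simp add: mult_ac)
    qed
    ultimately show False by (simp add: field_simps)
  qed
qed

section \<open>Runs\<close>

lemma constraint_violation_feasible:
  "x \<in> feasible_set X c J \<Longrightarrow> constraint_violation X c J x = 0"
  by (auto simp: feasible_set_def constraint_violation_def max_def power2_eq_square intro!: sum.neutral)

text \<open>Otherwise \<open>f i y < f i x\<close> for every \<open>i\<close>; the index type is
  nonempty, so \<open>y\<close> would dominate \<open>x\<close>.\<close>

lemma not_pareto_lessD: "\<not> pareto_less f y x \<Longrightarrow> \<exists>i. f i x \<le> f i y"
  unfolding pareto_less_def by (meson linear not_le)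

section \<open>Frame sizes and the evaluation of poll points\<close>

context dmulti_mads
begin

text \<open>Positivity propagates from \<Delta>0, since an update only copies a frame size or
  rescales the current one by \<tau> or its inverse. The hypothesis \<open>step\<close> is loose
  enough to cover the update rules of both variants.\<close>

lemma frame_pos_inductive:
  assumes frame: "\<And>k. \<exists>x\<in>evaluated R k. frame R k = frame_size R k x"
    and step: "\<And>k x. x \<in> evaluated R (Suc k) \<Longrightarrow> frame_size R (Suc k) x \<in>
      {frame R k, \<tau> * frame R k, inverse \<tau> * frame R k} \<union> frame_size R k ` evaluated R k"
  shows "0 < frame R k"
proof -
  have "\<forall>x\<in>evaluated R k. 0 < frame_size R k x"
  proof (induction k)
    case 0
    then show ?case using init_frame_size Delta0_pos by auto
  next
    case (Suc k)
    have "0 < frame R k" using Suc frame[of k] by auto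
    with tau(1) have "0 < \<tau> * frame R k" "0 < inverse \<tau> * frame R k" by simp_all
    with Suc \<open>0 < frame R k\<close> step[of _ k] show ?case by fastforce
  qed
  with frame[of k] show ?thesis by auto
qed

lemma LF_D: "(x, \<Delta>) \<in> LF k \<Longrightarrow> x \<in> evaluated R k \<and> x \<in> \<Omega> \<and> \<Delta> = frame_size R k x"
  by (auto simp: LF_def undominated_feasible_def)

lemma LI_D: "(x, \<Delta>) \<in> LI k \<Longrightarrow> x \<in> evaluated R k \<and> \<Delta> = frame_size R k x"
  by (auto simp: LI_def I_def U_def Let_def)

lemma poll_dirs_bound:
  "d \<in> poll_dirs R k x \<Longrightarrow> mesh_size R k * norm d \<le> b * frame R k"
  using feas_dirs(3) infeas_dirs(3) by (auto simp: poll_dirs_def)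

lemma unsuccessful_poll_evaluated:
  assumes "k \<in> unsuccessful R" "x \<in> centers R k" "d \<in> poll_dirs R k x"
    and "x + mesh_size R k *\<^sub>R d \<in> X"
  shows "x + mesh_size R k *\<^sub>R d \<in> evaluated R (Suc k)"
  using assms poll_complete[of k] evaluated_Suc[of k] by (auto simp: poll_set_def)

text \<open>The variants choose the infeasible center differently; the last hypothesis retains what
  they share. If \<open>LF k\<close> is empty, \<open>some_center\<close> forces an infeasible
  center to exist.\<close>

lemma frame_eq_frame_size:
  assumes "feas_center_rule k" "frame_rule k"
    and "\<And>x \<Delta>. infeas_center R k = Some (x, \<Delta>) \<Longrightarrow> x \<in> evaluated R k \<and> \<Delta> = frame_size R k x"
  shows "\<exists>x\<in>evaluated R k. frame R k = frame_size R k x"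
proof (cases "LF k = {}")
  case True
  with assms(1) some_center[of k] obtain x \<Delta> where "infeas_center R k = Some (x, \<Delta>)"
    by (auto simp: feas_center_rule_def)
  with assms(2,3) True show ?thesis by (auto simp: frame_rule_def)
next
  case False
  with assms(1) obtain x \<Delta> where "feas_center R k = Some (x, \<Delta>)"
    by (auto simp: feas_center_rule_def)
  moreover from this assms(1) have "(x, \<Delta>) \<in> LF k" by (auto simp: feas_center_rule_def)
  ultimately show ?thesis using LF_D[of x \<Delta> k] assms(2) False by (auto simp: frame_rule_def)
qed

end

lemma (in dmulti_mads_pb) frame_pos: "0 < frame R k"
proof (rule frame_pos_inductive)
  fix k
  show "\<exists>x\<in>evaluated R k. frame R k = frame_size R k x"
    using infeas_center[of k] LI_D
    by (intro frame_eq_frame_size feas_center frame) (auto simp: infeas_center_rule_def)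
  show "frame_size R (Suc k) x \<in>
      {frame R k, \<tau> * frame R k, inverse \<tau> * frame R k} \<union> frame_size R k ` evaluated R k"
    if "x \<in> evaluated R (Suc k)" for x
    using frame_size[of k] that unfolding frame_size_rule_pb_def
    by (cases "x \<in> evaluated R k") auto
qed

lemma (in dmulti_mads_teb) frame_pos: "0 < frame R k"
proof (rule frame_pos_inductive)
  fix k
  show "\<exists>x\<in>evaluated R k. frame R k = frame_size R k x"
    using infeas_center[of k]
    by (intro frame_eq_frame_size feas_center frame)
      (auto simp: infeas_center_rule_teb_def split: if_splits)
  show "frame_size R (Suc k) x \<in>
      {frame R k, \<tau> * frame R k, inverse \<tau> * frame R k} \<union> frame_size R k ` evaluated R k"
    if "x \<in> evaluated R (Suc k)" for x
    using frame_size[of k] that unfolding frame_size_rule_teb_def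
    by (cases "x \<in> evaluated R k") (auto split: if_splits)
qed

section \<open>Objective values at the poll points of unsuccessful iterations\<close>

lemma (in dmulti_mads_pb) unsuccessful_no_descent:
  assumes "k \<in> unsuccessful R" "feas_center R k = Some (x, \<Delta>)"
    and "y \<in> evaluated R (Suc k)" "y \<in> \<Omega>"
  shows "\<exists>i. f i x \<le> f i y"
proof (rule not_pareto_lessD)
  have "x \<in> \<Omega>" using assms(2) feas_center[of k] LF_D by (auto simp: feas_center_rule_def)
  \<comment> \<open>A feasible \<open>y\<close> has \<open>h y = 0\<close>, so dominance over the
    center would make the iteration dominating.\<close>
  moreover have "\<not> dominates_f \<Omega> f y x"
    using assms unsuccessful_iff[of k] constraint_violation_feasible[of y X c J]
    unfolding dominating_def by blast
  ultimately show "\<not> pareto_less f y x" using assms(4) by (simp add: dominates_f_def)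
qed

text \<open>A feasible center shows that the second phase has begun, and the extreme barrier agrees
  with \<open>f\<close> on \<Omega>, so failure of the success test is non-dominance for
  \<open>f\<close> itself.\<close>

lemma (in dmulti_mads_teb) unsuccessful_no_descent:
  assumes "k \<in> unsuccessful R" "feas_center R k = Some (x, \<Delta>)"
    and "y \<in> evaluated R (Suc k)" "y \<in> \<Omega>"
  shows "\<exists>i. f i x \<le> f i y"
proof (rule not_pareto_lessD)
  have x: "x \<in> \<Omega>" "x \<in> evaluated R k"
    using assms(2) feas_center[of k] LF_D by (auto simp: feas_center_rule_def)
  then have "\<not> phase_one k" by (auto simp: phase_one_def)
  then have "\<not> dominates_f \<Omega> (extreme_barrier \<Omega> f) y x"
    using assms unsuccessful_iff[of k] unfolding successful_teb_def by auto
  then show "\<not> pareto_less f y x"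
    using x(1) assms(4) by (simp add: dominates_f_def pareto_less_def extreme_barrier_def)
qed

text \<open>One late index \<open>k\<close> of a subsequence defining a refining direction near
  \<open>v\<close> suffices: the base point is the center \<open>xF k\<close> and the second point a
  poll point. Hypertangency makes the poll point feasible, and failure of the iteration then gives
  an objective that does not decrease.\<close>

lemma (in dmulti_mads) refining_no_descent:
  assumes frame_pos: "\<And>k. 0 < frame R k"
    and no_descent: "\<And>k x \<Delta> y. \<lbrakk>k \<in> unsuccessful R; feas_center R k = Some (x, \<Delta>);
      y \<in> evaluated R (Suc k); y \<in> \<Omega>\<rbrakk> \<Longrightarrow> \<exists>i. f i x \<le> f i y"
    and refining: "feasible_refining_subsequence R K xF xhat"
    and feasible: "\<And>k. k \<in> K \<Longrightarrow> xF k \<in> \<Omega>"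
    and v: "v \<in> hypertangent_cone \<Omega> xhat" "v \<in> closure (refining_directions X R K xF)"
    and "0 < r"
  shows "\<exists>y s v' i. y \<in> \<Omega> \<inter> ball xhat r \<and> 0 < s \<and> s < r \<and> v' \<in> ball v r \<and> y + s *\<^sub>R v' \<in> \<Omega>
        \<and> f i y \<le> f i (y + s *\<^sub>R v')"
proof -
  obtain \<epsilon> where \<epsilon>: "0 < \<epsilon>"
    "\<And>y v' t. \<lbrakk>y \<in> \<Omega> \<inter> ball xhat \<epsilon>; v' \<in> ball v \<epsilon>; 0 < t; t < \<epsilon>\<rbrakk> \<Longrightarrow> y + t *\<^sub>R v' \<in> \<Omega>"
    using v(1) unfolding hypertangent_cone_def by blast
  define q where "q = min r \<epsilon>"
  have q: "0 < q" "q \<le> r" "q \<le> \<epsilon>" using \<open>0 < r\<close> \<epsilon>(1) by (auto simp: q_def)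
  have K: "K \<subseteq> unsuccessful R" "\<And>k. k \<in> K \<Longrightarrow> xF k \<in> centers R k"
    "(frame R \<longlongrightarrow> 0) (along K)" "(xF \<longlongrightarrow> xhat) (along K)"
    "\<And>k. k \<in> K \<Longrightarrow> \<exists>\<Delta>. feas_center R k = Some (xF k, \<Delta>)"
    using refining unfolding feasible_refining_subsequence_def refining_subsequence_def by auto
  \<comment> \<open>\<open>v\<close> is only a limit of refining directions; as the ball is open,
    the normalised poll directions tending to \<open>d\<close> eventually enter it too.\<close>
  obtain d where d: "d \<in> refining_directions X R K xF" "d \<in> ball v q"
    using v(2) q(1) by (metis closure_approachable dist_commute mem_ball)
  then obtain K' dk where K': "infinite K'" "K' \<subseteq> K"
    and dk: "\<And>k. k \<in> K' \<Longrightarrow> dk k \<in> poll_dirs R k (xF k)" "\<And>k. k \<in> K' \<Longrightarrow> dk k \<noteq> 0"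
      "\<And>k. k \<in> K' \<Longrightarrow> xF k + mesh_size R k *\<^sub>R dk k \<in> X"
    and lim: "((\<lambda>k. dk k /\<^sub>R norm (dk k)) \<longlongrightarrow> d) (along K')"
    unfolding refining_directions_def by blast
  have le: "along K' \<le> along K" using K'(2) by (intro inf_mono) auto
  have "\<forall>\<^sub>F k in along K'. dk k /\<^sub>R norm (dk k) \<in> ball v q"
    using topological_tendstoD[OF lim open_ball d(2)] .
  moreover have "\<forall>\<^sub>F k in along K'. xF k \<in> ball xhat q"
    using topological_tendstoD[OF tendsto_mono[OF le K(4)] open_ball] q(1) by simp
  \<comment> \<open>The length of a poll step is at most \<open>b * frame R k\<close>, so it
    vanishes along the subsequence.\<close>
  moreover have "((\<lambda>k. b * frame R k) \<longlongrightarrow> 0) (along K')"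
    using tendsto_mult_right_zero[OF tendsto_mono[OF le K(3)]] .
  then have "\<forall>\<^sub>F k in along K'. b * frame R k < q"
    using q(1) by (rule order_tendstoD)
  moreover have "\<forall>\<^sub>F k in along K'. k \<in> K'"
    by (simp add: eventually_inf_principal)
  ultimately have "\<forall>\<^sub>F k in along K'. k \<in> K' \<and> dk k /\<^sub>R norm (dk k) \<in> ball v q \<and>
      xF k \<in> ball xhat q \<and> b * frame R k < q"
    by eventually_elim auto
  \<comment> \<open>Since \<open>K'\<close> is infinite, an eventual property along it holds at some
    actual index.\<close>
  moreover have "along K' \<noteq> bot"
    using K'(1) by (auto simp: trivial_limit_def eventually_inf_principal eventually_sequentially
        infinite_nat_iff_unbounded_le)
  ultimately obtain k where k: "k \<in> K'" "dk k /\<^sub>R norm (dk k) \<in> ball v q" "xF k \<in> ball xhat q"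
      "b * frame R k < q"
    using eventually_happens by blast
  define s where "s = mesh_size R k * norm (dk k)"
  have "0 < mesh_size R k" using frame_pos[of k] by (simp add: mesh_size_def)
  then have s: "0 < s" "s < q"
    using dk(2)[OF k(1)] poll_dirs_bound[OF dk(1)[OF k(1)]] k(4) by (auto simp: s_def)
  have eq: "xF k + s *\<^sub>R (dk k /\<^sub>R norm (dk k)) = xF k + mesh_size R k *\<^sub>R dk k"
    using dk(2)[OF k(1)] by (simp add: s_def)
  have kK: "k \<in> K" using k(1) K'(2) by blast
  \<comment> \<open>The refining direction only guarantees that the poll point lies in
    \<open>X\<close>; non-dominance speaks of points of \<Omega>.\<close>
  have \<Omega>: "xF k + s *\<^sub>R (dk k /\<^sub>R norm (dk k)) \<in> \<Omega>"
    using k(2,3) s q feasible[OF kK] by (intro \<epsilon>(2)) auto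
  have "xF k + mesh_size R k *\<^sub>R dk k \<in> evaluated R (Suc k)"
    using unsuccessful_poll_evaluated K(1,2) kK dk(1,3) k(1) by blast
  then obtain i where "f i (xF k) \<le> f i (xF k + s *\<^sub>R (dk k /\<^sub>R norm (dk k)))"
    using no_descent[of k "xF k"] K(1) K(5)[OF kK] kK \<Omega> unfolding eq by blast
  with k(2,3) s q \<Omega> feasible[OF kK] show ?thesis
    by (intro exI[of _ "xF k"] exI[of _ s] exI[of _ "dk k /\<^sub>R norm (dk k)"] exI[of _ i]) auto
qed

theorem theorem5p4:
  fixes X :: "(real^'n) set"
    and f :: "'m::finite \<Rightarrow> real^'n \<Rightarrow> ereal"
    and c :: "'j \<Rightarrow> real^'n \<Rightarrow> ereal"
    and J :: "'j set"
    and G :: "real^'n^'n"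
    and Z :: "int^'d^'n"
    and \<tau> b \<Delta>0 :: real
    and w :: nat
    and R :: "(real^'n) mads_run"
    and K :: "nat set"
    and xF :: "nat \<Rightarrow> real^'n"
    and xhat :: "real^'n"
  defines "\<Omega> \<equiv> feasible_set X c J"
    and "h \<equiv> constraint_violation X c J"
  assumes run: "dmulti_mads_teb X f c J G Z \<tau> w b \<Delta>0 R \<or> dmulti_mads_pb X f c J G Z \<tau> w b \<Delta>0 R"
    and finite_start: "\<exists>x0 \<in> evaluated R 0. x0 \<in> X \<and> (\<forall>i. \<bar>f i x0\<bar> \<noteq> \<infinity>) \<and> \<bar>h x0\<bar> \<noteq> \<infinity>"
    and bounded_iterates: "bounded (\<Union>k. evaluated R k)"
    and refining: "feasible_refining_subsequence R K xF xhat"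
    and in_F: "\<forall>k\<in>K. xF k \<in> undominated_feasible \<Omega> f (evaluated R k)"
    and xhat_feasible: "xhat \<in> \<Omega>"
    and lipschitz: "lipschitz_near X f xhat"
    and hypertangent: "hypertangent_cone \<Omega> xhat \<noteq> {}"
    and dense: "{d \<in> clarke_tangent_cone \<Omega> xhat. norm d = 1} \<subseteq> closure (refining_directions X R K xF)"
  shows "pareto_clarke_critical X \<Omega> f xhat"
proof -
  have base: "dmulti_mads X f c J G Z \<tau> b \<Delta>0 R"
    using run by (elim disjE) (rule dmulti_mads_teb.axioms(1) dmulti_mads_pb.axioms(1), assumption)+
  have frame_pos: "0 < frame R k" for k
    using run dmulti_mads_teb.frame_pos dmulti_mads_pb.frame_pos by metis
  have no_descent: "\<exists>i. f i x \<le> f i y"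
    if "k \<in> unsuccessful R" "feas_center R k = Some (x, \<Delta>)" "y \<in> evaluated R (Suc k)" "y \<in> \<Omega>"
    for k x \<Delta> y
    using run that dmulti_mads_teb.unsuccessful_no_descent dmulti_mads_pb.unsuccessful_no_descent
    unfolding \<Omega>_def by metis
  have feasible: "xF k \<in> \<Omega>" if "k \<in> K" for k
    using in_F that by (auto simp: undominated_feasible_def)
  have sub: "\<Omega> \<subseteq> X" by (auto simp: \<Omega>_def feasible_set_def)
  obtain u where u: "u \<in> hypertangent_cone \<Omega> xhat" using hypertangent by blast
  show ?thesis
  proof (rule pareto_clarke_critical_if_no_descent[OF sub _ lipschitz u])
    show "xhat \<in> X" using sub xhat_feasible by blast
    fix v :: "real^'n" and r :: real
    assume v: "v \<in> hypertangent_cone \<Omega> xhat" "norm v = 1" and "0 < r"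
    \<comment> \<open>The density hypothesis concerns unit Clarke tangent vectors, so the
      hypertangent \<open>v\<close> is first placed in that cone.\<close>
    have "v \<in> clarke_tangent_cone \<Omega> xhat"
      using hypertangent_subset_clarke_tangent[of xhat \<Omega>] closure_subset xhat_feasible v(1) by blast
    with v(2) dense have "v \<in> closure (refining_directions X R K xF)" by blast
    with v(1) \<open>0 < r\<close> show "\<exists>y s w' i. y \<in> \<Omega> \<inter> ball xhat r \<and> 0 < s \<and> s < r \<and> w' \<in> ball v r \<and>
        y + s *\<^sub>R w' \<in> \<Omega> \<and> f i y \<le> f i (y + s *\<^sub>R w')"
      using dmulti_mads.refining_no_descent[OF base frame_pos _ refining, of v r] no_descent feasible
      unfolding \<Omega>_def by blast
  qed
qed

end
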